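(* Let $\mathcal{M}_1=(E,\mathcal{I}_1)$ be a matroid of rank $r$ with set of bases $\mathcal{X}_1$, let $w:E\to\mathbb{Z}_{\ge0}$ and let $o:E\to\mathcal{C}=\{\eta_1,\dots,\eta_K\}$ be an assignment of ordered categories. Then the set of efficient bases of (MMPO) is a superset of the set of efficient bases of (MMPCmin) and of the set of efficient bases of (MMPCmax).
   Context: Bases of a matroid on a finite ground set $E$ all have the same cardinality $r$. Objective functions: $w(B)=\sum_{e\in B}w(e)$ for $B\in\mathcal{X}_1$. $\mathcal{C}=\{\eta_1,\dots,\eta_K\}$ is totally ordered by $\eta_i\prec\eta_j$ iff $i<j$, and $\eta_i\preceq\eta_j$ iff $i\le j$. For a basis $B$, $o(B)=(o_1(B),\dots,o_r(B))\in\mathcal{C}^r$ is the vector of categories of the elements of $B$ sorted in non-decreasing order. For $j=1,\dots,K$, $c_j(B)=|\{e\in B:o(e)=\eta_j\}|$, $c^{\max}_j(B)=c_j(B)$ and $c^{\min}_j(B)=c_{K-j+1}(B)$. Orders: "$o(B_1)$ is at least as good as $o(B_2)$" means $o_i(B_1)\preceq o_i(B_2)$ for all $i=1,\dots,r$. For real vectors, $y^1<_{\mathrm{lex}}y^2$ iff there is $k$ with $y^1_k<y^2_k$ and $y^1_i=y^2_i$ for $i<k$; $y^1\leqq_{\mathrm{lex}}y^2$ iff $y^1<_{\mathrm{lex}}y^2$ or $y^1=y^2$. Problems (over $B\in\mathcal{X}_1$) and dominance: (MMPO): minimize $(w(B),o(B))$; $B'$ dominates $B''$ if $w(B')\le w(B'')$,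 $o_i(B')\preceq o_i(B'')$ for all $i$, and $(w(B'),o(B'))\ne(w(B''),o(B''))$. (MMPCmin): minimize $w(B)$ and lexicographically minimize $c^{\min}(B)$; $B'$ dominates $B''$ if $w(B')\le w(B'')$, $c^{\min}(B')\leqq_{\mathrm{lex}}c^{\min}(B'')$, and $(w(B'),c^{\min}(B'))\ne(w(B''),c^{\min}(B''))$. (MMPCmax): minimize $w(B)$ and lexicographically maximize $c^{\max}(B)$; $B'$ dominates $B''$ if $w(B')\le w(B'')$, $c^{\max}(B'')\leqq_{\mathrm{lex}}c^{\max}(B')$, and $(w(B'),c^{\max}(B'))\ne(w(B''),c^{\max}(B''))$. A basis is efficient for a problem if no basis dominates it in that problem. *)

theory Defs
  imports "HOL-Library.Multiset"
begin

locale matroid =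
  fixes E :: "'a set" and \<I> :: "'a set set"
  assumes finite_ground: "finite E"
    and indep_subset_ground: "X \<in> \<I> \<Longrightarrow> X \<subseteq> E"
    and empty_indep: "{} \<in> \<I>"
    and indep_subset: "X \<in> \<I> \<Longrightarrow> Y \<subseteq> X \<Longrightarrow> Y \<in> \<I>"
    and augment: "X \<in> \<I> \<Longrightarrow> Y \<in> \<I> \<Longrightarrow> card X < card Y \<Longrightarrow> \<exists>y\<in>Y - X. insert y X \<in> \<I>"

definition bases :: "'a set set \<Rightarrow> 'a set set" where
  "bases \<I> = {B \<in> \<I>. \<forall>X\<in>\<I>. B \<subseteq> X \<longrightarrow> X = B}"

definition matroid_rank :: "'a set set \<Rightarrow> nat" where
  "matroid_rank \<I> = Max (card ` \<I>)"

lemma (in matroid) card_basis: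
  assumes "B \<in> bases \<I>"
  shows "card B = matroid_rank \<I>"
proof -
  have B: "B \<in> \<I>" and max: "\<And>X. X \<in> \<I> \<Longrightarrow> B \<subseteq> X \<Longrightarrow> X = B"
    using assms by (auto simp: bases_def)
  have "\<I> \<subseteq> Pow E"
    using indep_subset_ground by blast
  then have fin: "finite \<I>"
    using finite_ground finite_subset by blast
  have "card X \<le> card B" if "X \<in> \<I>" for X
  proof (rule ccontr)
    assume "\<not> card X \<le> card B"
    then obtain y where "y \<in> X - B" "insert y B \<in> \<I>"
      using augment[OF B \<open>X \<in> \<I>\<close>] by auto
    with max[of "insert y B"] show False by blast
  qed
  with B fin show ?thesis
    unfolding matroid_rank_def by (intro Max_eqI[symmetric]) auto
qed

definition basis_weight :: "('a \<Rightarrow> nat) \<Rightarrow> 'a set \<Rightarrow> nat" where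
  "basis_weight w B = (\<Sum>e\<in>B. w e)"

text \<open>Vectors are lists, hence indexed from 0: the entry with mathematical index \<open>i\<close> is
  at position \<open>i - 1\<close>. A category assignment is a function \<open>cat\<close> into a linear order, and
  \<open>\<eta> 1 < ... < \<eta> K\<close> are the categories.\<close>

definition category_vec :: "('a \<Rightarrow> 'c::linorder) \<Rightarrow> 'a set \<Rightarrow> 'c list" where
  "category_vec cat B = sorted_list_of_multiset (image_mset cat (mset_set B))"

lemma length_category_vec [simp]: "length (category_vec cat B) = card B"
  by (simp add: category_vec_def flip: size_mset)

definition category_count :: "('a \<Rightarrow> 'c) \<Rightarrow> (nat \<Rightarrow> 'c) \<Rightarrow> 'a set \<Rightarrow> nat \<Rightarrow> nat" where
  "category_count cat \<eta> B j = card {e \<in> B. cat e = \<eta> j}"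

definition cmax :: "('a \<Rightarrow> 'c) \<Rightarrow> (nat \<Rightarrow> 'c) \<Rightarrow> nat \<Rightarrow> 'a set \<Rightarrow> nat list" where
  "cmax cat \<eta> K B = map (\<lambda>j. category_count cat \<eta> B j) [1..<K + 1]"

definition cmin :: "('a \<Rightarrow> 'c) \<Rightarrow> (nat \<Rightarrow> 'c) \<Rightarrow> nat \<Rightarrow> 'a set \<Rightarrow> nat list" where
  "cmin cat \<eta> K B = map (\<lambda>j. category_count cat \<eta> B (K - j + 1)) [1..<K + 1]"

definition lex_less :: "'b::linorder list \<Rightarrow> 'b list \<Rightarrow> bool" where
  "lex_less ys zs \<longleftrightarrow> length ys = length zs \<and>
     (\<exists>k<length ys. ys ! k < zs ! k \<and> (\<forall>i<k. ys ! i = zs ! i))"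

definition lex_le :: "'b::linorder list \<Rightarrow> 'b list \<Rightarrow> bool" where
  "lex_le ys zs \<longleftrightarrow> lex_less ys zs \<or> ys = zs"

definition mmpo_dominates ::
  "nat \<Rightarrow> ('a \<Rightarrow> nat) \<Rightarrow> ('a \<Rightarrow> 'c::linorder) \<Rightarrow> 'a set \<Rightarrow> 'a set \<Rightarrow> bool" where
  "mmpo_dominates r w cat B' B'' \<longleftrightarrow>
     basis_weight w B' \<le> basis_weight w B'' \<and>
     (\<forall>i<r. category_vec cat B' ! i \<le> category_vec cat B'' ! i) \<and>
     (basis_weight w B', category_vec cat B') \<noteq> (basis_weight w B'', category_vec cat B'')"

definition mmpcmin_dominates ::
  "('a \<Rightarrow> nat) \<Rightarrow> ('a \<Rightarrow> 'c) \<Rightarrow> (nat \<Rightarrow> 'c) \<Rightarrow> nat \<Rightarrow> 'a set \<Rightarrow> 'a set \<Rightarrow> bool" where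
  "mmpcmin_dominates w cat \<eta> K B' B'' \<longleftrightarrow>
     basis_weight w B' \<le> basis_weight w B'' \<and>
     lex_le (cmin cat \<eta> K B') (cmin cat \<eta> K B'') \<and>
     (basis_weight w B', cmin cat \<eta> K B') \<noteq> (basis_weight w B'', cmin cat \<eta> K B'')"

definition mmpcmax_dominates ::
  "('a \<Rightarrow> nat) \<Rightarrow> ('a \<Rightarrow> 'c) \<Rightarrow> (nat \<Rightarrow> 'c) \<Rightarrow> nat \<Rightarrow> 'a set \<Rightarrow> 'a set \<Rightarrow> bool" where
  "mmpcmax_dominates w cat \<eta> K B' B'' \<longleftrightarrow>
     basis_weight w B' \<le> basis_weight w B'' \<and>
     lex_le (cmax cat \<eta> K B'') (cmax cat \<eta> K B') \<and>
     (basis_weight w B', cmax cat \<eta> K B') \<noteq> (basis_weight w B'', cmax cat \<eta> K B'')"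

definition efficient :: "'b set \<Rightarrow> ('b \<Rightarrow> 'b \<Rightarrow> bool) \<Rightarrow> 'b set" where
  "efficient \<X> dominates = {B \<in> \<X>. \<not> (\<exists>B'\<in>\<X>. dominates B' B)}"

end

theory Submission
  imports Defs
begin

text \<open>If \<open>B'\<close> is at least as good as \<open>B\<close> componentwise, then for every down-closed set of
  categories \<open>B'\<close> has at least as many elements in it as \<open>B\<close>. Applied to an initial segment of
  the categories, this shows that at the first category where the counts differ, \<open>B'\<close> has the
  larger count; applied to a final segment, that at the last such category it has the smaller one.
  As the counts determine the sorted category vector, dominance in MMPO implies dominance in both
  counting problems, so that fewer bases can be efficient for those.\<close>

text \<open>Only the first position where the vectors differ matters: there the second assumption
  gives \<le>, and the difference makes it strict.\<close>

lemma lex_leI: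
  assumes "length ys = length zs"
    and "\<And>k. k < length ys \<Longrightarrow> \<forall>i<k. ys ! i = zs ! i \<Longrightarrow> ys ! k \<le> zs ! k"
  shows "lex_le ys zs"
proof (cases "ys = zs")
  case False
  then have "\<exists>k. k < length ys \<and> ys ! k \<noteq> zs ! k"
    using assms(1) nth_equalityI by blast
  then obtain k where k: "k < length ys" "ys ! k \<noteq> zs ! k"
    and least: "\<forall>i<k. \<not> (i < length ys \<and> ys ! i \<noteq> zs ! i)"
    by (subst (asm) exists_least_iff) blast
  have eq: "\<forall>i<k. ys ! i = zs ! i"
    using least k(1) by (meson less_trans)
  have "ys ! k < zs ! k"
    using assms(2)[OF k(1) eq] k(2) by simp
  then show ?thesis
    using assms(1) k(1) eq by (auto simp: lex_le_def lex_less_def)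
qed (simp add: lex_le_def)

lemma mset_category_vec: "mset (category_vec cat B) = image_mset cat (mset_set B)"
  by (simp add: category_vec_def)

text \<open>Sorting keeps multiplicities, so elements can be counted as positions of the vector,
  where a componentwise comparison applies.\<close>

lemma card_category_vec:
  assumes "finite B"
  shows "card {e \<in> B. P (cat e)} = card {i. i < card B \<and> P (category_vec cat B ! i)}"
proof -
  have "card {e \<in> B. P (cat e)} = size (filter_mset P (image_mset cat (mset_set B)))"
    using assms by (simp add: filter_mset_image_mset)
  also have "\<dots> = length (filter P (category_vec cat B))"
    by (simp flip: mset_category_vec mset_filter)
  finally show ?thesis
    by (simp add: length_filter_conv_card)
qed

lemma card_categories_eq_sum:
  assumes "finite B" and "inj_on \<eta> {1..K}" and "\<forall>e\<in>B. cat e \<in> \<eta> ` {1..K}"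
  shows "card {e \<in> B. P (cat e)} = (\<Sum>i | i \<in> {1..K} \<and> P (\<eta> i). category_count cat \<eta> B i)"
proof -
  have "{e \<in> B. P (cat e)} = (\<Union>i\<in>{i \<in> {1..K}. P (\<eta> i)}. {e \<in> B. cat e = \<eta> i})"
    using assms(3) by fastforce
  then show ?thesis
    unfolding category_count_def
    using assms(1) by (simp only:) (rule card_UN_disjoint, auto simp: inj_on_eq_iff[OF assms(2)])
qed

lemma category_vec_eqI:
  assumes "finite B'" "finite B" and "inj_on \<eta> {1..K}"
    and "\<forall>e\<in>B'. cat e \<in> \<eta> ` {1..K}" "\<forall>e\<in>B. cat e \<in> \<eta> ` {1..K}"
    and "\<And>j. j \<in> {1..K} \<Longrightarrow> category_count cat \<eta> B' j = category_count cat \<eta> B j"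
  shows "category_vec cat B' = category_vec cat B"
proof -
  \<comment> \<open>Both sums run over the same indices and agree term by term; for \<open>c\<close>
    outside the categories they are empty.\<close>
  have "card {e \<in> B'. cat e = c} = card {e \<in> B. cat e = c}" for c
    using card_categories_eq_sum[OF assms(1,3,4), of "\<lambda>x. x = c"]
      card_categories_eq_sum[OF assms(2,3,5), of "\<lambda>x. x = c"] assms(6)
    by simp
  moreover have "count (image_mset cat (mset_set A)) c = card {e \<in> A. cat e = c}"
    if "finite A" for A c
    using that by (simp add: count_image_mset' eq_commute[of c] flip: sum.inter_filter)
  ultimately have "image_mset cat (mset_set B') = image_mset cat (mset_set B)"
    using assms(1,2) by (simp only: multiset_eq_iff simp_thms)
  then show ?thesis
    by (simp add: category_vec_def)
qed

text \<open>This is the part of dominance in MMPO that concerns categories, freed from weights and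
  matroids. Equal cardinalities give both vectors the same positions.\<close>

locale at_least_as_good =
  fixes cat :: "'a \<Rightarrow> 'c::linorder" and \<eta> :: "nat \<Rightarrow> 'c" and K :: nat and B' B :: "'a set"
  assumes strict_mono: "strict_mono_on {1..K} \<eta>"
    and fin: "finite B'" "finite B"
    and range: "\<forall>e\<in>B'. cat e \<in> \<eta> ` {1..K}" "\<forall>e\<in>B. cat e \<in> \<eta> ` {1..K}"
    and card_eq: "card B' = card B"
    and vec_le: "\<And>i. i < card B \<Longrightarrow> category_vec cat B' ! i \<le> category_vec cat B ! i"
begin

lemma inj: "inj_on \<eta> {1..K}"
  using strict_mono by (rule strict_mono_on_imp_inj_on)

lemma \<eta>_le_iff: "i \<in> {1..K} \<Longrightarrow> j \<in> {1..K} \<Longrightarrow> \<eta> i \<le> \<eta> j \<longleftrightarrow> i \<le> j"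
  using strict_mono by (rule strict_mono_on_less_eq)

text \<open>By transitivity, each position where the vector of \<open>B\<close> is at most
  \<open>c\<close> is also such a position for \<open>B'\<close>.\<close>

lemma card_lower_le: "card {e \<in> B. cat e \<le> c} \<le> card {e \<in> B'. cat e \<le> c}"
  unfolding card_category_vec[OF fin(1), where P = "\<lambda>x. x \<le> c"]
    card_category_vec[OF fin(2), where P = "\<lambda>x. x \<le> c"]
  by (rule card_mono) (auto simp: card_eq intro: order_trans[OF vec_le])

lemma card_upper_le: "card {e \<in> B'. c \<le> cat e} \<le> card {e \<in> B. c \<le> cat e}"
  unfolding card_category_vec[OF fin(1), where P = "\<lambda>x. c \<le> x"]
    card_category_vec[OF fin(2), where P = "\<lambda>x. c \<le> x"]
  by (rule card_mono) (auto simp: card_eq intro: order_trans[OF _ vec_le])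

text \<open>The counts of the categories up to \<open>\<eta> j\<close> add up to the cardinalities
  compared in \<open>card_lower_le\<close>. The terms before \<open>j\<close> cancel, which leaves
  the comparison at \<open>j\<close>.\<close>

lemma count_le_if_eq_below:
  assumes "j \<in> {1..K}"
    and "\<And>i. i \<in> {1..<j} \<Longrightarrow> category_count cat \<eta> B i = category_count cat \<eta> B' i"
  shows "category_count cat \<eta> B j \<le> category_count cat \<eta> B' j"
proof -
  have "{i. i \<in> {1..K} \<and> \<eta> i \<le> \<eta> j} = insert j {1..<j}"
    using assms(1) by (auto simp: \<eta>_le_iff)
  then show ?thesis
    using card_lower_le[of "\<eta> j"] assms(2)
    by (simp add: card_categories_eq_sum[OF fin(1) inj range(1), where P = "\<lambda>x. x \<le> \<eta> j"]
        card_categories_eq_sum[OF fin(2) inj range(2), where P = "\<lambda>x. x \<le> \<eta> j"])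
qed

lemma count_le_if_eq_above:
  assumes "j \<in> {1..K}"
    and "\<And>i. i \<in> {j<..K} \<Longrightarrow> category_count cat \<eta> B' i = category_count cat \<eta> B i"
  shows "category_count cat \<eta> B' j \<le> category_count cat \<eta> B j"
proof -
  have "{i. i \<in> {1..K} \<and> \<eta> j \<le> \<eta> i} = insert j {j<..K}"
    using assms(1) by (auto simp: \<eta>_le_iff)
  then show ?thesis
    using card_upper_le[of "\<eta> j"] assms(2)
    by (simp add: card_categories_eq_sum[OF fin(1) inj range(1), where P = "\<lambda>x. \<eta> j \<le> x"]
        card_categories_eq_sum[OF fin(2) inj range(2), where P = "\<lambda>x. \<eta> j \<le> x"])
qed

lemma cmax_lex_le: "lex_le (cmax cat \<eta> K B) (cmax cat \<eta> K B')"
proof (rule lex_leI)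
  fix k
  assume k: "k < length (cmax cat \<eta> K B)"
    and eq: "\<forall>i<k. cmax cat \<eta> K B ! i = cmax cat \<eta> K B' ! i"
  have nth: "cmax cat \<eta> K A ! i = category_count cat \<eta> A (Suc i)" if "i < K" for A i
    using that by (simp add: cmax_def del: upt_Suc)
  have "k < K"
    using k by (simp add: cmax_def del: upt_Suc)
  have "category_count cat \<eta> B (Suc k) \<le> category_count cat \<eta> B' (Suc k)"
  proof (rule count_le_if_eq_below)
    fix i assume "i \<in> {1..<Suc k}"
    then have "i - 1 < k" "Suc (i - 1) = i"
      using \<open>k < K\<close> by auto
    then show "category_count cat \<eta> B i = category_count cat \<eta> B' i"
      using eq[rule_format, of "i - 1"] \<open>k < K\<close> by (simp add: nth)
  qed (use \<open>k < K\<close> in auto)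
  then show "cmax cat \<eta> K B ! k \<le> cmax cat \<eta> K B' ! k"
    using \<open>k < K\<close> by (simp add: nth)
qed (simp add: cmax_def)

lemma cmin_lex_le: "lex_le (cmin cat \<eta> K B') (cmin cat \<eta> K B)"
proof (rule lex_leI)
  fix k
  assume k: "k < length (cmin cat \<eta> K B')"
    and eq: "\<forall>i<k. cmin cat \<eta> K B' ! i = cmin cat \<eta> K B ! i"
  \<comment> \<open>Position \<open>i\<close> has mathematical index \<open>i + 1\<close>, hence
    holds category \<open>K - (i + 1) + 1\<close>. The first \<open>k\<close> positions are thus the
    categories above \<open>K - k\<close>.\<close>
  have nth: "cmin cat \<eta> K A ! i = category_count cat \<eta> A (K - i)" if "i < K" for A i
    using that by (simp add: cmin_def Suc_diff_Suc del: upt_Suc)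
  have "k < K"
    using k by (simp add: cmin_def del: upt_Suc)
  have "category_count cat \<eta> B' (K - k) \<le> category_count cat \<eta> B (K - k)"
  proof (rule count_le_if_eq_above)
    fix i assume "i \<in> {K - k<..K}"
    then have "K - i < k" "K - (K - i) = i"
      using \<open>k < K\<close> by auto
    then show "category_count cat \<eta> B' i = category_count cat \<eta> B i"
      using eq[rule_format, of "K - i"] \<open>k < K\<close> by (simp add: nth)
  qed (use \<open>k < K\<close> in auto)
  then show "cmin cat \<eta> K B' ! k \<le> cmin cat \<eta> K B ! k"
    using \<open>k < K\<close> by (simp add: nth)
qed (simp add: cmin_def)

lemma category_vec_eq_if_cmax_eq:
  assumes "cmax cat \<eta> K B' = cmax cat \<eta> K B"
  shows "category_vec cat B' = category_vec cat B"
  by (rule category_vec_eqI[OF fin inj range]) (use assms in \<open>auto simp: cmax_def\<close>)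

lemma category_vec_eq_if_cmin_eq:
  assumes "cmin cat \<eta> K B' = cmin cat \<eta> K B"
  shows "category_vec cat B' = category_vec cat B"
proof (rule category_vec_eqI[OF fin inj range])
  fix j assume j: "j \<in> {1..K}"
  \<comment> \<open>The reversal of indices is an involution, so the count of category
    \<open>j\<close> is the entry with index \<open>K - j + 1\<close>.\<close>
  then have "K - j + 1 \<in> set [1..<K + 1]"
    by auto
  with assms have "category_count cat \<eta> B' (K - (K - j + 1) + 1)
      = category_count cat \<eta> B (K - (K - j + 1) + 1)"
    unfolding cmin_def map_eq_conv by blast
  then show "category_count cat \<eta> B' j = category_count cat \<eta> B j"
    using j by (simp add: Suc_diff_le)
qed

end

text \<open>Both bases have cardinality \<open>matroid_rank \<I>\<close>, so dominance compares
  their vectors at every position.\<close>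

lemma (in matroid) at_least_as_goodI:
  assumes "strict_mono_on {1..K} \<eta>" and "\<forall>e\<in>E. cat e \<in> \<eta> ` {1..K}"
    and "B' \<in> bases \<I>" "B \<in> bases \<I>"
    and "mmpo_dominates (matroid_rank \<I>) w cat B' B"
  shows "at_least_as_good cat \<eta> K B' B"
proof -
  have "B' \<subseteq> E" "B \<subseteq> E"
    using assms(3,4) indep_subset_ground by (auto simp: bases_def)
  then show ?thesis
    using assms card_basis finite_subset[OF _ finite_ground]
    by unfold_locales (auto simp: mmpo_dominates_def)
qed

theorem theorem7:
  fixes E :: "'a set" and \<I> :: "'a set set" and r K :: nat
    and w :: "'a \<Rightarrow> nat" and cat :: "'a \<Rightarrow> 'c::linorder" and \<eta> :: "nat \<Rightarrow> 'c"
  assumes "matroid E \<I>"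
    and "r = matroid_rank \<I>"
    and "strict_mono_on {1..K} \<eta>"
    and "\<forall>e\<in>E. cat e \<in> \<eta> ` {1..K}"
  shows "efficient (bases \<I>) (mmpcmin_dominates w cat \<eta> K)
           \<subseteq> efficient (bases \<I>) (mmpo_dominates r w cat) \<and>
         efficient (bases \<I>) (mmpcmax_dominates w cat \<eta> K)
           \<subseteq> efficient (bases \<I>) (mmpo_dominates r w cat)"
proof -
  have "mmpcmin_dominates w cat \<eta> K B' B \<and> mmpcmax_dominates w cat \<eta> K B' B"
    if "B' \<in> bases \<I>" "B \<in> bases \<I>" and dom: "mmpo_dominates r w cat B' B" for B' B
  proof -
    interpret at_least_as_good cat \<eta> K B' B
      using matroid.at_least_as_goodI[OF assms(1,3,4)] that assms(2) by blast
    \<comment> \<open>Dominance also needs the pairs to differ: equal weights and equal count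
      vectors would force equal category vectors, against \<open>dom\<close>.\<close>
    show ?thesis
      using dom cmin_lex_le cmax_lex_le category_vec_eq_if_cmin_eq category_vec_eq_if_cmax_eq
      by (auto simp: mmpo_dominates_def mmpcmin_dominates_def mmpcmax_dominates_def)
  qed
  then show ?thesis
    unfolding efficient_def by blast
qed

end
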